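(* Consider a matrix of ratings $\mathcal R=(R_{ui})$, with set of items $\mathcal I$, set of users $\mathcal U$ and set of $k$ users' sensitive attributes $\mathcal A=\{A_1,\ldots,A_k\}$. Let the users' reputations and items' rankings be computed with the basic reputation-based ranking scheme (defined in the context). If the multi-attribute mitigation step (defined in the context) is applied to recompute users' reputations and items' rankings, using the attributes $A_1,\ldots,A_k$, then the following property holds: for any two classes of any two sensitive attributes, $a\in A_i$ and $a'\in A_j$ ($A_i,A_j\in\mathcal A$), the recomputed reputations of the set of users $\mathcal U(a)$ and the recomputed reputations of the set of users $\mathcal U(a')$ have zero disparate reputation, i.e. $$\mathrm{avg}(\{c_u:u\in\mathcal U(a)\})=\mathrm{avg}(\{c_u:u\in\mathcal U(a')\}).$$
   Context: Ratings: $\mathcal U=\{u_1,\ldots,u_n\}$ is a finite set of users and $\mathcal I=\{i_1,\ldots,i_m\}$ a finite set of items. Ratings are normalized to lie in $]0,1]$: $R_{ui}\in\,]0,1]$ if user $u$ rated item $i$, and $R_{ui}=0$ if not. $\mathcal U_i=\{u\in\mathcal U:R_{ui}>0\}$ is the set of users who rated item $i$ and $\mathcal I_u=\{i\in\mathcal I:R_{ui}>0\}$ is the set of items rated by user $u$. Attributes: $k>0$, and each attribute $A_j=\{a_{j,1},\ldots,a_{j,s_j}\}$ is a finite set of classes; $A_j(u)\in A_j$ denotes the class of attribute $A_j$ to which user $u$ belongs. For $a\in A_j$, $\mathcal U(a)=\{u\in\mathcal U:A_j(u)=a\}$; for distinct classes of the same attribute these sets are disjoint. For $l=(a_1,\ldots,a_k)\in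 A_1\times\cdots\times A_k$, $\mathcal U(l)=\{u\in\mathcal U:A_j(u)=a_j\text{ for }j=1,\ldots,k\}$; these sets form a partition of $\mathcal U$. Notation: $\mathrm{avg}(v)=\frac1n\sum_{i=1}^n v_i$ and $\mathrm{std}(v)=\sqrt{\frac1n\sum_{i=1}^n(v_i-\mathrm{avg}(v))^2}$. Basic reputation-based ranking scheme: with $\lambda\in\,]0,1[$ and initial reputations $c_u^0\in\,]0,1]$ (the choice $c_u^0=1$ is used), iterate $$r_i^{t+1}=\frac{\sum_{u\in\mathcal U_i}R_{ui}c_u^t}{\sum_{u\in\mathcal U_i}c_u^t},\qquad c_u^{t+1}=1-\frac{\lambda}{|\mathcal I_u|}\sum_{i\in\mathcal I_u}|R_{ui}-r_i^{t+1}| .$$ $c_u^N$ denotes the reputation of user $u$ after $N$ iterations. Multi-attribute mitigation step: for $l\in A_1\times\cdots\times A_k$, let $\mu_l=\mathrm{avg}(\{c_u^N:u\in\mathcal U(l)\})$, $\sigma_l=\mathrm{std}(\{c_u^N:u\in\mathcal U(l)\})$, $\mu=\min_l\mu_l$ and $\sigma=\min_l\sigma_l$. The final reputations $c_u$ and final rankings $r_i$ are $$c_u=\mu+(c_u^N-\mu_l)\frac{\sigma}{\sigma_l}\quad\text{for }u\in\mathcal U(l),\ l\in A_1\times\cdots\times A_k,\qquad r_i=\frac{\sum_{u\in\mathcal U_i}R_{ui}c_u}{\sum_{u\in\mathcal U_i}c_u}.$$ Disparate reputation between two classes is the difference of the average reputations of the users belonging to the two classes. *)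

theory Defs
  imports Complex_Main "HOL-Library.FuncSet"
begin

text \<open>
  Families such as \<open>{c_u : u \<in> S}\<close> are indexed by users, so equal values are counted with
  multiplicity. Both functions are \<open>0\<close> on an empty family.
\<close>

definition avg :: "('u \<Rightarrow> real) \<Rightarrow> 'u set \<Rightarrow> real" where
  "avg v S = (\<Sum>u\<in>S. v u) / real (card S)"

definition std :: "('u \<Rightarrow> real) \<Rightarrow> 'u set \<Rightarrow> real" where
  "std v S = sqrt ((\<Sum>u\<in>S. (v u - avg v S)\<^sup>2) / real (card S))"

definition disparate_reputation :: "('u \<Rightarrow> real) \<Rightarrow> 'u set \<Rightarrow> 'u set \<Rightarrow> real" where
  "disparate_reputation c S T = avg c S - avg c T"


definition raters :: "'u set \<Rightarrow> ('u \<Rightarrow> 'i \<Rightarrow> real) \<Rightarrow> 'i \<Rightarrow> 'u set" where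
  "raters Us R i = {u \<in> Us. R u i > 0}"

definition rated_items :: "'i set \<Rightarrow> ('u \<Rightarrow> 'i \<Rightarrow> real) \<Rightarrow> 'u \<Rightarrow> 'i set" where
  "rated_items Is R u = {i \<in> Is. R u i > 0}"

definition ranking :: "'u set \<Rightarrow> ('u \<Rightarrow> 'i \<Rightarrow> real) \<Rightarrow> ('u \<Rightarrow> real) \<Rightarrow> 'i \<Rightarrow> real" where
  "ranking Us R c i = (\<Sum>u\<in>raters Us R i. R u i * c u) / (\<Sum>u\<in>raters Us R i. c u)"

text \<open>
  A user without ratings gets reputation \<open>1\<close> after every step, because \<open>\<lambda> / 0 = 0\<close>.
\<close>

primrec reputation ::
    "'u set \<Rightarrow> 'i set \<Rightarrow> ('u \<Rightarrow> 'i \<Rightarrow> real) \<Rightarrow> real \<Rightarrow> ('u \<Rightarrow> real) \<Rightarrow> nat \<Rightarrow> 'u \<Rightarrow> real" where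
  "reputation Us Is R lam c0 0 = c0"
| "reputation Us Is R lam c0 (Suc t) = (\<lambda>u.
     1 - lam / real (card (rated_items Is R u)) *
       (\<Sum>i\<in>rated_items Is R u. \<bar>R u i - ranking Us R (reputation Us Is R lam c0 t) i\<bar>))"


text \<open>
  The attributes are indexed by \<open>{1..k}\<close>; \<open>A j\<close> is the set of classes of attribute \<open>j\<close>, and
  \<open>cls j u\<close> is the class of user \<open>u\<close>. Since attributes may share class names, the set
  \<open>\<U>(a)\<close> also takes the attribute index. Tuples in \<open>A\<^sub>1 \<times> \<dots> \<times> A\<^sub>k\<close> are
  the elements of \<open>PiE {1..k} A\<close>.
\<close>

definition class_users :: "'u set \<Rightarrow> (nat \<Rightarrow> 'u \<Rightarrow> 'c) \<Rightarrow> nat \<Rightarrow> 'c \<Rightarrow> 'u set" where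
  "class_users Us cls j a = {u \<in> Us. cls j u = a}"

definition tuple_users :: "'u set \<Rightarrow> nat \<Rightarrow> (nat \<Rightarrow> 'u \<Rightarrow> 'c) \<Rightarrow> (nat \<Rightarrow> 'c) \<Rightarrow> 'u set" where
  "tuple_users Us k cls l = {u \<in> Us. \<forall>j\<in>{1..k}. cls j u = l j}"

text \<open>
  The minima of \<open>\<mu>\<^sub>l\<close> and \<open>\<sigma>\<^sub>l\<close> range over the tuples with at least one user, as the
  average and the standard deviation of an empty family are undefined.
\<close>

definition inhabited_tuples ::
    "'u set \<Rightarrow> nat \<Rightarrow> (nat \<Rightarrow> 'c set) \<Rightarrow> (nat \<Rightarrow> 'u \<Rightarrow> 'c) \<Rightarrow> (nat \<Rightarrow> 'c) set" where
  "inhabited_tuples Us k A cls = {l \<in> PiE {1..k} A. tuple_users Us k cls l \<noteq> {}}"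

definition min_avg ::
    "'u set \<Rightarrow> nat \<Rightarrow> (nat \<Rightarrow> 'c set) \<Rightarrow> (nat \<Rightarrow> 'u \<Rightarrow> 'c) \<Rightarrow> ('u \<Rightarrow> real) \<Rightarrow> real" where
  "min_avg Us k A cls c =
     Min ((\<lambda>l. avg c (tuple_users Us k cls l)) ` inhabited_tuples Us k A cls)"

definition min_std ::
    "'u set \<Rightarrow> nat \<Rightarrow> (nat \<Rightarrow> 'c set) \<Rightarrow> (nat \<Rightarrow> 'u \<Rightarrow> 'c) \<Rightarrow> ('u \<Rightarrow> real) \<Rightarrow> real" where
  "min_std Us k A cls c =
     Min ((\<lambda>l. std c (tuple_users Us k cls l)) ` inhabited_tuples Us k A cls)"

definition user_tuple :: "nat \<Rightarrow> (nat \<Rightarrow> 'u \<Rightarrow> 'c) \<Rightarrow> 'u \<Rightarrow> nat \<Rightarrow> 'c" where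
  "user_tuple k cls u = (\<lambda>j\<in>{1..k}. cls j u)"

text \<open>
  If \<open>\<sigma>\<^sub>l = 0\<close>, then all reputations in \<open>\<U>(l)\<close> equal \<open>\<mu>\<^sub>l\<close>, and the formula
  gives the value \<open>\<mu>\<close> for these users.
\<close>

definition mitigated_reputation ::
    "'u set \<Rightarrow> nat \<Rightarrow> (nat \<Rightarrow> 'c set) \<Rightarrow> (nat \<Rightarrow> 'u \<Rightarrow> 'c) \<Rightarrow> ('u \<Rightarrow> real) \<Rightarrow> 'u \<Rightarrow> real" where
  "mitigated_reputation Us k A cls c u =
     (let S = tuple_users Us k cls (user_tuple k cls u)
      in min_avg Us k A cls c + (c u - avg c S) * (min_std Us k A cls c / std c S))"

lemma user_tuple_eq:
  assumes "l \<in> PiE {1..k} A" and "u \<in> tuple_users Us k cls l"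
  shows "user_tuple k cls u = l"
  using assms by (auto simp: user_tuple_def tuple_users_def PiE_def extensional_def fun_eq_iff)

lemma mitigated_reputation_tuple:
  assumes "l \<in> PiE {1..k} A" and "u \<in> tuple_users Us k cls l"
  shows "mitigated_reputation Us k A cls c u =
    min_avg Us k A cls c + (c u - avg c (tuple_users Us k cls l)) *
      (min_std Us k A cls c / std c (tuple_users Us k cls l))"
  using user_tuple_eq[OF assms] by (simp add: mitigated_reputation_def Let_def)

end

(* The tuples of classes refine every single class: U(a) is a disjoint union of nonempty sets U(l)
   with l_j = a. On each U(l) the deviations from the mean sum to zero, and rescaling them by
   sigma / sigma_l keeps this, so the mitigated reputations have average mu on each U(l), hence on
   U(a). *)
theory Submission
  imports Defs
begin

lemma sum_diff_avg: "(\<Sum>u\<in>S. v u - avg v S) = 0"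
  \<comment> \<open>For infinite \<open>S\<close> the sum is \<open>0\<close> by convention; for
    finite \<open>S\<close> the total of \<open>v\<close> cancels against \<open>card S\<close>
    copies of the average.\<close>
  by (cases "finite S") (auto simp: avg_def sum_subtractf)

text \<open>Since \<open>j\<close> is among the indices of the tuple, agreeing with \<open>w\<close>
  on all attributes forces class \<open>a\<close> for attribute \<open>j\<close>. Hence a tuple
  block that meets the class lies wholly inside it.\<close>

lemma user_tuple_fibre:
  assumes "j \<in> {1..k}" and "w \<in> class_users Us cls j a"
  shows "{u \<in> class_users Us cls j a. user_tuple k cls u = user_tuple k cls w} =
    tuple_users Us k cls (user_tuple k cls w)"
  using assms
  by (auto simp: class_users_def user_tuple_def tuple_users_def fun_eq_iff restrict_def)

lemma sum_mitigated_deviation: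
  assumes "l \<in> extensional {1..k}"
  shows "(\<Sum>u\<in>tuple_users Us k cls l. mitigated_reputation Us k A cls c u - min_avg Us k A cls c) = 0"
proof -
  let ?S = "tuple_users Us k cls l"
  have "mitigated_reputation Us k A cls c u - min_avg Us k A cls c =
      (c u - avg c ?S) * (min_std Us k A cls c / std c ?S)" if "u \<in> ?S" for u
    \<comment> \<open>With \<open>UNIV\<close> as every set of classes, membership in
      \<open>PiE\<close> reduces to extensionality of \<open>l\<close>.\<close>
    using user_tuple_eq[of l k "\<lambda>_. UNIV" u Us cls] that assms
    by (simp add: mitigated_reputation_def Let_def PiE_def)
  then have "(\<Sum>u\<in>?S. mitigated_reputation Us k A cls c u - min_avg Us k A cls c) =
      (\<Sum>u\<in>?S. c u - avg c ?S) * (min_std Us k A cls c / std c ?S)"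
    by (simp only: sum_distrib_right cong: sum.cong)
  then show ?thesis
    by (simp add: sum_diff_avg)
qed

text \<open>Summing deviations from \<open>min_avg\<close>, instead of averaging block averages,
  avoids weighting the blocks by their sizes.\<close>

lemma avg_mitigated_class_users:
  assumes "finite Us" and "j \<in> {1..k}" and "class_users Us cls j a \<noteq> {}"
  shows "avg (mitigated_reputation Us k A cls c) (class_users Us cls j a) = min_avg Us k A cls c"
proof -
  let ?S = "class_users Us cls j a" and ?m = "mitigated_reputation Us k A cls c"
  let ?mu = "min_avg Us k A cls c"
  have fin: "finite ?S"
    using assms(1) by (simp add: class_users_def)
  have "(\<Sum>u\<in>?S. ?m u - ?mu) =
      (\<Sum>l\<in>user_tuple k cls ` ?S. \<Sum>u\<in>{u \<in> ?S. user_tuple k cls u = l}. ?m u - ?mu)"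
    by (rule sum.image_gen[OF fin])
  also have "\<dots> = 0"
  proof (rule sum.neutral, rule ballI)
    fix l assume "l \<in> user_tuple k cls ` ?S"
    then obtain w where w: "w \<in> ?S" "l = user_tuple k cls w"
      by blast
    have "{u \<in> ?S. user_tuple k cls u = l} = tuple_users Us k cls l"
      using user_tuple_fibre[OF assms(2) w(1)] w(2) by simp
    moreover have "l \<in> extensional {1..k}"
      using w(2) by (simp add: user_tuple_def)
    ultimately show "(\<Sum>u\<in>{u \<in> ?S. user_tuple k cls u = l}. ?m u - ?mu) = 0"
      by (simp only: sum_mitigated_deviation)
  qed
  finally have "(\<Sum>u\<in>?S. ?m u) = real (card ?S) * ?mu"
    by (simp add: sum_subtractf)
  then show ?thesis
    \<comment> \<open>A nonempty finite class has nonzero cardinality, which cancels; on an empty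
      class \<open>avg\<close> would be \<open>0\<close>.\<close>
    using fin assms(3) by (simp add: avg_def)
qed

theorem theorem1:
  fixes Us :: "'u set" and Is :: "'i set" and R :: "'u \<Rightarrow> 'i \<Rightarrow> real"
    and lam :: real and c0 :: "'u \<Rightarrow> real" and N :: nat
    and k :: nat and A :: "nat \<Rightarrow> 'c set" and cls :: "nat \<Rightarrow> 'u \<Rightarrow> 'c"
    and i j :: nat and a a' :: 'c and c :: "'u \<Rightarrow> real"
  assumes "finite Us" and "finite Is"
    and "\<And>u x. u \<in> Us \<Longrightarrow> x \<in> Is \<Longrightarrow> 0 \<le> R u x \<and> R u x \<le> 1"
    and "0 < lam" and "lam < 1"
    and "\<And>u. u \<in> Us \<Longrightarrow> 0 < c0 u \<and> c0 u \<le> 1"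
    and "k > 0"
    and "\<And>m. m \<in> {1..k} \<Longrightarrow> finite (A m)"
    and "\<And>m u. m \<in> {1..k} \<Longrightarrow> u \<in> Us \<Longrightarrow> cls m u \<in> A m"
    and "c = mitigated_reputation Us k A cls (reputation Us Is R lam c0 N)"
    and "i \<in> {1..k}" and "a \<in> A i" and "class_users Us cls i a \<noteq> {}"
    and "j \<in> {1..k}" and "a' \<in> A j" and "class_users Us cls j a' \<noteq> {}"
  shows "disparate_reputation c (class_users Us cls i a) (class_users Us cls j a') = 0 \<and>
    avg c (class_users Us cls i a) = avg c (class_users Us cls j a')"
  \<comment> \<open>Both averages equal the same \<open>min_avg\<close>, a value that depends on
    neither the attribute nor the class.\<close>
  using assms(1,10,11,13,14,16) by (simp add: disparate_reputation_def avg_mitigated_class_users)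

end
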